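(* The multiset $$C=\prod_{n\in\{p^k\mid p\in\mathbb{P},\,k\in\{1,2,3,\dots\}\}\cup\{1\}}\mathrm{D}_n$$ (product in $\mathsf{MS}$) is a regular injective regular co-generator of $\mathsf{MS}$. Moreover, every arrow from a power of $C$ to $C$ factors through an at most countable sub-power.
   Context: Supernatural numbers: let $\mathbb{P}$ be the set of primes and $\mathbb{N}=\{0,1,2,\dots\}$. A supernatural number is a function $\nu\colon\mathbb{P}\to\mathbb{N}\cup\{\infty\}$; $\mathcal{N}$ is the set of supernatural numbers, a complete lattice under the pointwise order. For $n\in\{1,2,3,\dots\}$, $\nu_n\in\mathcal{N}$ sends $p$ to the exponent of $p$ in the prime factorisation of $n$. $\mathcal{N}$ carries the topology with open basis $U_n=\{\nu\in\mathcal{N}\mid\nu\ge\nu_n\}$, $n\ge 1$. Multisets: a Boolean space is a compact Hausdorff space with a basis of clopen sets. The category $\mathsf{MS}$ of multisets has as objects the pairs $(X,\zeta_X)$ with $X$ a Boolean space and $\zeta_X\colon X\to\mathcal{N}$ continuous; an arrow $f\colon(X,\zeta_X)\to(Y,\zeta_Y)$ is a continuous function $f\colon X\to Y$ such that $\zeta_X(x)\ge\zeta_Y(f(x))$ for every $x\in X$. $\mathsf{MS}$ is complete and cocomplete; a product in $\mathsf{MS}$ is the product of the underlying spaces with denominator $\zeta((x_i)_i)=\bigvee_i\zeta_{X_i}(x_i)$. For $n\ge 1$, $\mathrm{D}_n$ is the multiset whose underlying space is the discrete space $\{0,1\}$, with $\zeta(0)=\nu_1$ and $\zeta(1)=\nu_n$.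 An object $X$ is regular injective if for every regular monic $g\colon B\to A$ (an equaliser of some parallel pair) and every arrow $f\colon B\to X$ there is $h\colon A\to X$ with $h\circ g=f$. An object $G$ is a regular co-generator if, for every object $X$, the canonical arrow $X\to\prod_{t\in\hom(X,G)}G$, whose $t$-component is $t$, is regular monic. An arrow $C^I\to C$ factors through an at most countable sub-power if it factors through the projection $C^I\to C^J$ for some at most countable $J\subseteq I$. *)

theory Defs
  imports "HOL-Analysis.Analysis" "HOL-Computational_Algebra.Primes"
begin

typedef prime_number = "{p::nat. prime p}"
  using two_is_prime_nat by blast

text \<open>The order on the function type is the pointwise one, so this is a complete lattice.\<close>
type_synonym supernatural = "prime_number \<Rightarrow> enat"

definition sn_of_nat :: "nat \<Rightarrow> supernatural" where
  "sn_of_nat n = (\<lambda>p. enat (multiplicity (Rep_prime_number p) n))"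

definition sn_up :: "nat \<Rightarrow> supernatural set" where
  "sn_up n = {\<nu>. sn_of_nat n \<le> \<nu>}"

text \<open>This is not the product topology that \<^typ>\<open>supernatural\<close> inherits as a function type.
  The lemma \<open>openin_sn_topology\<close> below shows that the generating sets form a basis.\<close>
definition sn_topology :: "supernatural topology" where
  "sn_topology = topology_generated_by (sn_up ` {1..})"

definition boolean_space :: "'a topology \<Rightarrow> bool" where
  "boolean_space X \<longleftrightarrow> compact_space X \<and> Hausdorff_space X \<and>
     (\<exists>\<B>. (\<forall>U\<in>\<B>. openin X U \<and> closedin X U) \<and>
          openin X = arbitrary union_of (\<lambda>U. U \<in> \<B>))"

datatype 'a ms = MS (ms_space: "'a topology") (denom: "'a \<Rightarrow> supernatural")

abbreviation ms_carrier :: "'a ms \<Rightarrow> 'a set" where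
  "ms_carrier X \<equiv> topspace (ms_space X)"

text \<open>The values of \<^const>\<open>denom\<close> outside the carrier are irrelevant.\<close>
definition is_ms :: "'a ms \<Rightarrow> bool" where
  "is_ms X \<longleftrightarrow> boolean_space (ms_space X) \<and>
     continuous_map (ms_space X) sn_topology (denom X)"

text \<open>Arrows are extensional functions, so that equality of arrows is equality in HOL and
  \<open>ms_hom X Y\<close> is the hom-set; composition is \<^const>\<open>compose\<close> on the source carrier.\<close>
definition ms_hom :: "'a ms \<Rightarrow> 'b ms \<Rightarrow> ('a \<Rightarrow> 'b) set" where
  "ms_hom X Y = {f \<in> extensional (ms_carrier X).
     continuous_map (ms_space X) (ms_space Y) f \<and>
     (\<forall>x\<in>ms_carrier X. denom X x \<ge> denom Y (f x))}"

abbreviation ms_comp :: "'a ms \<Rightarrow> ('b \<Rightarrow> 'c) \<Rightarrow> ('a \<Rightarrow> 'b) \<Rightarrow> 'a \<Rightarrow> 'c" where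
  "ms_comp X g f \<equiv> compose (ms_carrier X) g f"

definition ms_prod :: "('i \<Rightarrow> 'a ms) \<Rightarrow> 'i set \<Rightarrow> ('i \<Rightarrow> 'a) ms" where
  "ms_prod X I = MS (product_topology (\<lambda>i. ms_space (X i)) I)
                    (\<lambda>x. SUP i\<in>I. denom (X i) (x i))"

abbreviation ms_power :: "'a ms \<Rightarrow> 'i set \<Rightarrow> ('i \<Rightarrow> 'a) ms" where
  "ms_power X I \<equiv> ms_prod (\<lambda>_. X) I"

text \<open>Objects live on arbitrary types, over which HOL cannot quantify inside a formula.  The
  types of the objects that a notion quantifies over are therefore passed as
  \<^typ>\<open>'w itself\<close> arguments.  Here \<open>'w\<close> is the type of the test objects; by the lemma
  \<open>is_equaliser_test_type\<close> below, its choice does not matter.\<close>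
definition is_equaliser ::
  "'w itself \<Rightarrow> 'e ms \<Rightarrow> 'a ms \<Rightarrow> 'z ms \<Rightarrow> ('e \<Rightarrow> 'a) \<Rightarrow> ('a \<Rightarrow> 'z) \<Rightarrow> ('a \<Rightarrow> 'z) \<Rightarrow> bool" where
  "is_equaliser (TW :: 'w itself) E A Z e u v \<longleftrightarrow>
     is_ms E \<and> is_ms A \<and> is_ms Z \<and>
     e \<in> ms_hom E A \<and> u \<in> ms_hom A Z \<and> v \<in> ms_hom A Z \<and>
     ms_comp E u e = ms_comp E v e \<and>
     (\<forall>(W :: 'w ms) h. is_ms W \<and> h \<in> ms_hom W A \<and> ms_comp W u h = ms_comp W v h \<longrightarrow>
        (\<exists>!k. k \<in> ms_hom W E \<and> ms_comp W e k = h))"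

text \<open>\<open>'z\<close> is the type carrying the target of the parallel pair.  The lemma
  \<open>regular_monic_target_type\<close> below shows that \<^typ>\<open>'a set \<Rightarrow> bool\<close> is always large enough.\<close>
definition regular_monic ::
  "'z itself \<Rightarrow> 'w itself \<Rightarrow> 'b ms \<Rightarrow> 'a ms \<Rightarrow> ('b \<Rightarrow> 'a) \<Rightarrow> bool" where
  "regular_monic (TZ :: 'z itself) (TW :: 'w itself) B A g \<longleftrightarrow>
     (\<exists>(Z :: 'z ms) u v. is_equaliser TYPE('w) B A Z g u v)"

definition regular_injective ::
  "'b itself \<Rightarrow> 'a itself \<Rightarrow> 'z itself \<Rightarrow> 'w itself \<Rightarrow> 'x ms \<Rightarrow> bool" where
  "regular_injective (TB :: 'b itself) (TA :: 'a itself) (TZ :: 'z itself) (TW :: 'w itself) X \<longleftrightarrow>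
     is_ms X \<and>
     (\<forall>(B :: 'b ms) (A :: 'a ms) g f.
        is_ms B \<and> is_ms A \<and> regular_monic TYPE('z) TYPE('w) B A g \<and> f \<in> ms_hom B X \<longrightarrow>
        (\<exists>h \<in> ms_hom A X. ms_comp B h g = f))"

definition canonical_arrow :: "'x ms \<Rightarrow> 'g ms \<Rightarrow> 'x \<Rightarrow> (('x \<Rightarrow> 'g) \<Rightarrow> 'g)" where
  "canonical_arrow X G = (\<lambda>x\<in>ms_carrier X. \<lambda>t\<in>ms_hom X G. t x)"

definition regular_cogenerator ::
  "'x itself \<Rightarrow> 'z itself \<Rightarrow> 'w itself \<Rightarrow> 'g ms \<Rightarrow> bool" where
  "regular_cogenerator (TX :: 'x itself) (TZ :: 'z itself) (TW :: 'w itself) G \<longleftrightarrow>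
     is_ms G \<and>
     (\<forall>X :: 'x ms. is_ms X \<longrightarrow>
        regular_monic TYPE('z) TYPE('w) X (ms_power G (ms_hom X G)) (canonical_arrow X G))"

definition factors_through_countable_subpower ::
  "'i set \<Rightarrow> 'c ms \<Rightarrow> (('i \<Rightarrow> 'c) \<Rightarrow> 'c) \<Rightarrow> bool" where
  "factors_through_countable_subpower I C f \<longleftrightarrow>
     (\<exists>J\<subseteq>I. countable J \<and>
        (\<exists>g \<in> ms_hom (ms_power C J) C.
           f = ms_comp (ms_power C I) g (\<lambda>x\<in>ms_carrier (ms_power C I). restrict x J)))"

text \<open>The two points \<open>0\<close> and \<open>1\<close> are \<^const>\<open>False\<close> and \<^const>\<open>True\<close>.\<close>
definition ms_D :: "nat \<Rightarrow> bool ms" where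
  "ms_D n = MS (discrete_topology UNIV) (\<lambda>b. if b then sn_of_nat n else sn_of_nat 1)"

definition ms_C :: "(nat \<Rightarrow> bool) ms" where
  "ms_C = ms_prod ms_D ({p ^ k | p k. prime p \<and> k \<ge> 1} \<union> {1})"


lemma sn_up_1: "sn_up 1 = UNIV"
  by (auto simp: sn_up_def sn_of_nat_def le_fun_def zero_enat_def [symmetric])

lemma sn_up_Int:
  assumes "m \<ge> 1" "n \<ge> 1"
  shows "sn_up m \<inter> sn_up n = sn_up (lcm m n)"
proof -
  have *: "multiplicity p (lcm m n) = max (multiplicity p m) (multiplicity p n)" if "prime p" for p :: nat
    using assms that by (intro multiplicity_lcm) auto
  have "sn_of_nat (lcm m n) = sup (sn_of_nat m) (sn_of_nat n)"
    by (rule ext) (use Rep_prime_number in \<open>auto simp: sn_of_nat_def sup_enat_def * max_def\<close>)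
  then show ?thesis by (auto simp: sn_up_def)
qed

lemma openin_sn_topology:
  "openin sn_topology = arbitrary union_of (\<lambda>U. U \<in> sn_up ` {1..})"
proof -
  let ?T = "arbitrary union_of (\<lambda>U. U \<in> sn_up ` {1..})"
  have "?T (S \<inter> T)" if "S \<in> sn_up ` {1..}" "T \<in> sn_up ` {1..}" for S T
  proof -
    from that obtain m n where mn: "S = sn_up m" "T = sn_up n" "m \<ge> 1" "n \<ge> 1" by auto
    then have "S \<inter> T = sn_up (lcm m n)" "lcm m n \<ge> 1"
      using sn_up_Int [of m n] by (auto simp: Suc_le_eq lcm_pos_nat)
    then show ?thesis by (intro arbitrary_union_of_inc) auto
  qed
  then have ist: "istopology ?T" unfolding istopology_base_eq by blast
  show ?thesis
  proof (intro ext iffI)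
    fix S assume "openin sn_topology S"
    then have "generate_topology_on (sn_up ` {1..}) S"
      by (simp add: sn_topology_def openin_topology_generated_by_iff)
    then show "?T S"
    proof induction
      case Empty then show ?case by (simp add: arbitrary_union_of_empty)
    next
      case (Int a b) then show ?case using ist unfolding istopology_def by blast
    next
      case (UN K) then show ?case using ist unfolding istopology_def by blast
    next
      case (Basis s) then show ?case by (rule arbitrary_union_of_inc)
    qed
  next
    fix S assume "?T S"
    then obtain \<U> where "\<U> \<subseteq> sn_up ` {1..}" "S = \<Union>\<U>"
      by (auto simp: union_of_def)
    moreover have "openin sn_topology U" if "U \<in> sn_up ` {1..}" for U
      using that unfolding sn_topology_def by (rule topology_generated_by_Basis)
    ultimately show "openin sn_topology S" by (blast intro: openin_Union)
  qed
qed

lemma topspace_sn_topology: "topspace sn_topology = UNIV"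
proof -
  have "openin sn_topology (sn_up 1)"
    unfolding sn_topology_def by (intro topology_generated_by_Basis) auto
  then show ?thesis using sn_up_1 openin_subset by fastforce
qed

lemma boolean_space_singleton: "boolean_space (discrete_topology {w})"
  unfolding boolean_space_def
proof (intro conjI exI [of _ "Pow {w}"])
  show "openin (discrete_topology {w}) = arbitrary union_of (\<lambda>U. U \<in> Pow {w})"
    unfolding openin_topology_base_unique by auto
qed (auto simp: compact_space_discrete_topology Hausdorff_space_discrete_topology)

lemma is_ms_singleton: "is_ms (MS (discrete_topology {w}) d)"
  by (simp add: is_ms_def boolean_space_singleton topspace_sn_topology)

lemma is_equaliser_iff:
  "is_equaliser TYPE('w) E A Z e u v \<longleftrightarrow>
     is_ms E \<and> is_ms A \<and> is_ms Z \<and>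
     e \<in> ms_hom E A \<and> u \<in> ms_hom A Z \<and> v \<in> ms_hom A Z \<and>
     inj_on e (ms_carrier E) \<and> e ` ms_carrier E = {a \<in> ms_carrier A. u a = v a} \<and>
     (\<forall>x\<in>ms_carrier E. denom E x = denom A (e x))" (is "?L \<longleftrightarrow> ?R")
proof
  assume L: ?L
  note L' = L [unfolded is_equaliser_def]
  have hom: "e \<in> ms_hom E A" "u \<in> ms_hom A Z" "v \<in> ms_hom A Z"
    and eq: "ms_comp E u e = ms_comp E v e" using L' by auto
  have ecar: "e x \<in> ms_carrier A" if "x \<in> ms_carrier E" for x
    using hom(1) that by (auto simp: ms_hom_def continuous_map_def)
  have euv: "u (e x) = v (e x)" if "x \<in> ms_carrier E" for x
    using fun_cong [OF eq, of x] that by (simp add: compose_def)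
  have ed: "denom A (e x) \<le> denom E x" if "x \<in> ms_carrier E" for x
    using hom(1) that by (auto simp: ms_hom_def)
  define w :: 'w where "w = undefined"
  define pt :: "supernatural \<Rightarrow> 'w ms" where "pt d = MS (discrete_topology {w}) (\<lambda>_. d)" for d
  have pt: "is_ms (pt d)" "ms_carrier (pt d) = {w}" for d
    by (auto simp: pt_def is_ms_singleton)
  have pt_hom: "(\<lambda>x\<in>{w}. a) \<in> ms_hom (pt d) Y \<longleftrightarrow> a \<in> ms_carrier Y \<and> denom Y a \<le> d"
    for a d and Y :: "'y ms"
    by (auto simp: ms_hom_def pt_def)
  have lift: "\<exists>!k. k \<in> ms_hom (pt d) E \<and> ms_comp (pt d) e k = (\<lambda>x\<in>{w}. a)"
    if "a \<in> ms_carrier A" "u a = v a" "denom A a \<le> d" for a d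
  proof -
    have "ms_comp (pt d) u (\<lambda>x\<in>{w}. a) = ms_comp (pt d) v (\<lambda>x\<in>{w}. a)"
      using that by (auto simp: pt compose_def fun_eq_iff)
    then show ?thesis using L' pt that pt_hom [of a d A] by blast
  qed
  have lift': "\<exists>x. x \<in> ms_carrier E \<and> denom E x \<le> d \<and> e x = a"
    if a: "a \<in> ms_carrier A" "u a = v a" "denom A a \<le> d" for a d
  proof -
    obtain k where k: "k \<in> ms_hom (pt d) E" "ms_comp (pt d) e k = (\<lambda>x\<in>{w}. a)"
      using lift [OF a] by blast
    have "e (k w) = a" using fun_cong [OF k(2), of w] by (simp add: pt compose_def)
    moreover have "k w \<in> ms_carrier E" "denom E (k w) \<le> d"
      using k(1) by (auto simp: ms_hom_def pt_def continuous_map_def)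
    ultimately show ?thesis by blast
  qed
  have inj: "inj_on e (ms_carrier E)"
  proof (rule inj_onI)
    fix x y assume xy: "x \<in> ms_carrier E" "y \<in> ms_carrier E" "e x = e y"
    define d where "d = sup (denom E x) (denom E y)"
    have d: "denom E x \<le> d" "denom E y \<le> d" by (auto simp: d_def)
    have "denom A (e x) \<le> d" using ed xy(1) d by (meson order_trans)
    from lift [OF ecar [OF xy(1)] euv [OF xy(1)] this]
    have "\<exists>!k. k \<in> ms_hom (pt d) E \<and> ms_comp (pt d) e k = (\<lambda>_\<in>{w}. e x)" .
    moreover have "(\<lambda>_\<in>{w}. x) \<in> ms_hom (pt d) E" "(\<lambda>_\<in>{w}. y) \<in> ms_hom (pt d) E"
      using xy d by (auto simp: pt_hom)
    moreover have "ms_comp (pt d) e (\<lambda>_\<in>{w}. x) = (\<lambda>_\<in>{w}. e x)"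
      "ms_comp (pt d) e (\<lambda>_\<in>{w}. y) = (\<lambda>_\<in>{w}. e x)"
      using xy by (auto simp: pt compose_def fun_eq_iff)
    ultimately have "(\<lambda>_\<in>{w}. x) = (\<lambda>_\<in>{w}. y)" by blast
    then show "x = y" by (metis insertI1 restrict_apply)
  qed
  have "e ` ms_carrier E = {a \<in> ms_carrier A. u a = v a}"
    using ecar euv lift' by (force intro: order_refl)
  moreover have "denom E x = denom A (e x)" if x: "x \<in> ms_carrier E" for x
  proof (rule antisym)
    obtain y where "y \<in> ms_carrier E" "denom E y \<le> denom A (e x)" "e y = e x"
      using lift' [OF ecar [OF x] euv [OF x] order_refl] by blast
    then show "denom E x \<le> denom A (e x)" using inj x by (auto dest: inj_onD)
  qed (use ed x in blast)
  ultimately show ?R using L' inj by blast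
next
  assume R: ?R
  then have hom: "e \<in> ms_hom E A" "u \<in> ms_hom A Z" "v \<in> ms_hom A Z"
    and inj: "inj_on e (ms_carrier E)"
    and im: "e ` ms_carrier E = {a \<in> ms_carrier A. u a = v a}"
    and den: "\<And>x. x \<in> ms_carrier E \<Longrightarrow> denom E x = denom A (e x)" by auto
  have cont: "continuous_map (ms_space E) (ms_space A) e" using hom by (auto simp: ms_hom_def)
  have "closed_map (ms_space E) (ms_space A) e"
    using R cont by (intro continuous_imp_closed_map) (auto simp: is_ms_def boolean_space_def)
  then have "embedding_map (ms_space E) (ms_space A) e"
    using cont inj by (intro injective_closed_imp_embedding_map)
  then have hm: "homeomorphic_map (ms_space E) (subtopology (ms_space A) (e ` ms_carrier E)) e"
    by (simp add: embedding_map_def)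
  then obtain r where r: "homeomorphic_maps (ms_space E)
      (subtopology (ms_space A) (e ` ms_carrier E)) e r"
    by (auto simp: homeomorphic_map_maps)
  have rc: "continuous_map (subtopology (ms_space A) (e ` ms_carrier E)) (ms_space E) r"
    using r by (simp add: homeomorphic_maps_def)
  have er: "e (r a) = a" if "a \<in> e ` ms_carrier E" for a
    using r that cont im by (auto simp: homeomorphic_maps_def)
  have rcar: "r a \<in> ms_carrier E" if "a \<in> e ` ms_carrier E" for a
    using rc that im by (auto simp: continuous_map_def)
  have "ms_comp E u e = ms_comp E v e" using im by (auto simp: compose_def fun_eq_iff)
  moreover have "\<exists>!k. k \<in> ms_hom W E \<and> ms_comp W e k = h"
    if W: "is_ms W" "h \<in> ms_hom W A" "ms_comp W u h = ms_comp W v h" for W :: "'w ms" and h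
  proof -
    have hW: "h x \<in> e ` ms_carrier E" if x: "x \<in> ms_carrier W" for x
      using fun_cong [OF W(3), of x] W(2) x im
      by (auto simp: compose_def ms_hom_def continuous_map_def)
    have hc: "continuous_map (ms_space W) (subtopology (ms_space A) (e ` ms_carrier E)) h"
      using W(2) hW by (auto simp: ms_hom_def continuous_map_in_subtopology)
    have hext: "h \<in> extensional (ms_carrier W)"
      and hd: "\<And>x. x \<in> ms_carrier W \<Longrightarrow> denom A (h x) \<le> denom W x"
      using W(2) by (auto simp: ms_hom_def)
    define k where "k = restrict (r \<circ> h) (ms_carrier W)"
    have kc: "continuous_map (ms_space W) (ms_space E) k"
      using continuous_map_compose [OF hc rc] by (rule continuous_map_eq) (simp add: k_def)
    have "k \<in> ms_hom W E"
      using kc hd hW rcar er den by (auto simp: ms_hom_def k_def)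
    moreover have "ms_comp W e k = h"
      using hext er hW by (auto simp: compose_def k_def fun_eq_iff extensional_def)
    moreover have "k' = k" if k': "k' \<in> ms_hom W E" "ms_comp W e k' = h" for k'
    proof (rule extensionalityI [of _ "ms_carrier W"])
      fix x assume x: "x \<in> ms_carrier W"
      have "e (k' x) = h x" using fun_cong [OF k'(2), of x] x by (simp add: compose_def)
      also have "\<dots> = e (k x)" using x er hW by (simp add: k_def)
      finally have "e (k' x) = e (k x)" .
      moreover have "k' x \<in> ms_carrier E"
        using k'(1) x by (auto simp: ms_hom_def continuous_map_def)
      moreover have "k x \<in> ms_carrier E" using kc x by (auto simp: continuous_map_def)
      ultimately show "k' x = k x" using inj by (simp add: inj_on_eq_iff)
    qed (use k' in \<open>auto simp: ms_hom_def k_def\<close>)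
    ultimately show ?thesis by blast
  qed
  ultimately show ?L using R unfolding is_equaliser_def by blast
qed

lemma is_equaliser_test_type:
  "is_equaliser TYPE('w) E A Z e u v \<longleftrightarrow> is_equaliser TYPE('w2) E A Z e u v"
  by (simp only: is_equaliser_iff)

lemma boolean_space_Cantor_cube:
  "boolean_space (product_topology (\<lambda>_. discrete_topology (UNIV :: bool set)) (UNIV :: 'i set))"
    (is "boolean_space ?X")
proof -
  have cl: "openin ?X (PiE UNIV U) \<and> closedin ?X (PiE UNIV U)"
    if "finite {i. U i \<noteq> UNIV}" for U :: "'i \<Rightarrow> bool set"
    using that by (auto simp: openin_PiE_gen closedin_product_topology)
  have "openin ?X = arbitrary union_of (\<lambda>U. U \<in> {U. openin ?X U \<and> closedin ?X U})"
    unfolding openin_topology_base_unique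
  proof (intro conjI allI impI)
    fix S x assume "openin ?X S \<and> x \<in> S"
    then obtain U where "finite {i. U i \<noteq> UNIV}" "x \<in> PiE UNIV U" "PiE UNIV U \<subseteq> S"
      by (auto simp: openin_product_topology_alt) 
    then show "\<exists>V. V \<in> {U. openin ?X U \<and> closedin ?X U} \<and> x \<in> V \<and> V \<subseteq> S"
      using cl [of U] by blast
  qed auto
  moreover have "compact_space ?X" "Hausdorff_space ?X"
    by (auto simp: compact_space_product_topology Hausdorff_space_product_topology
        compact_space_discrete_topology)
  ultimately show ?thesis
    unfolding boolean_space_def
    by (intro conjI exI [of _ "{U. openin ?X U \<and> closedin ?X U}"]) auto
qed

lemma regular_monic_target_type:
  fixes A :: "'a ms" and B :: "'b ms"
  assumes "regular_monic TYPE('z) TYPE('w) B A g"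
  shows "regular_monic TYPE('a set \<Rightarrow> bool) TYPE('w2) B A g"
proof -
  from assms obtain Z :: "'z ms" and u v where "is_equaliser TYPE('w) B A Z g u v"
    by (auto simp: regular_monic_def)
  note R = this [unfolded is_equaliser_iff]
  let ?X = "ms_space A" and ?K = "g ` ms_carrier B"
  have A: "compact_space ?X" "Hausdorff_space ?X" and B: "compact_space (ms_space B)"
    using R by (auto simp: is_ms_def boolean_space_def)
  obtain \<B> where \<B>: "\<forall>U\<in>\<B>. openin ?X U \<and> closedin ?X U"
    "openin ?X = arbitrary union_of (\<lambda>U. U \<in> \<B>)"
    using R by (auto simp: is_ms_def boolean_space_def)
  have gc: "continuous_map (ms_space B) ?X g" using R by (auto simp: ms_hom_def)
  have K: "compactin ?X ?K" using image_compactin [OF _ gc] B by (simp add: compact_space_def)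
  define c where "c = (\<lambda>U. openin ?X U \<and> closedin ?X U \<and> ?K \<subseteq> U)"
  have sep: "\<exists>U. c U \<and> a \<notin> U" if a: "a \<in> ms_carrier A" "a \<notin> ?K" for a
  proof -
    have "\<exists>V. V \<in> \<B> \<and> x \<in> V \<and> a \<notin> V" if x: "x \<in> ?K" for x
    proof -
      have "openin ?X (ms_carrier A - {a})"
        using A a by (intro openin_diff closedin_Hausdorff_singleton) auto
      moreover have "x \<in> ms_carrier A - {a}"
        using x a gc by (auto simp: continuous_map_def)
      ultimately show ?thesis using \<B>(2) unfolding openin_topology_base_unique by blast
    qed
    then have "?K \<subseteq> \<Union>{V \<in> \<B>. a \<notin> V}" by blast
    moreover have "\<And>V. V \<in> {V \<in> \<B>. a \<notin> V} \<Longrightarrow> openin ?X V" using \<B>(1) by blast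
    ultimately have "\<exists>F. finite F \<and> F \<subseteq> {V \<in> \<B>. a \<notin> V} \<and> ?K \<subseteq> \<Union>F"
      by (intro compactinD [OF K])
    then obtain F where F: "finite F" "F \<subseteq> {V \<in> \<B>. a \<notin> V}" "?K \<subseteq> \<Union>F"
      by (elim exE conjE)
    have "openin ?X (\<Union>F)" using F(2) \<B>(1) by (intro openin_Union) blast
    moreover have "closedin ?X (\<Union>F)" using F(1,2) \<B>(1) by (intro closedin_Union) blast+
    ultimately have "c (\<Union>F)" using F(3) by (simp add: c_def)
    then show ?thesis using F by blast
  qed
  define P where "P = product_topology (\<lambda>_. discrete_topology (UNIV :: bool set)) (UNIV :: 'a set set)"
  define Y where "Y = MS P (\<lambda>_. sn_of_nat 1)"
  have Y: "is_ms Y"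
    by (simp add: Y_def is_ms_def P_def boolean_space_Cantor_cube topspace_sn_topology)
  define u' where "u' = (\<lambda>a\<in>ms_carrier A. \<lambda>U. c U \<longrightarrow> a \<in> U)"
  define v' where "v' = (\<lambda>a\<in>ms_carrier A. \<lambda>U :: 'a set. True)"
  have bot: "sn_of_nat 1 \<le> \<nu>" for \<nu> using sn_up_1 by (auto simp: sn_up_def)
  have "continuous_map ?X (discrete_topology UNIV) (\<lambda>a. u' a U)" for U
  proof (cases "c U")
    case True
    have "openin ?X {x \<in> ms_carrier A. u' x U \<in> T}" for T
    proof -
      have "{x \<in> ms_carrier A. u' x U \<in> T} =
        (if True \<in> T then U else {}) \<union> (if False \<in> T then ms_carrier A - U else {})"
        using True by (auto simp: u'_def c_def dest: openin_subset) (metis (full_types))+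
      then show ?thesis using True by (auto simp: c_def intro!: openin_Un openin_diff)
    qed
    then show ?thesis by (auto simp: continuous_map_def)
  next
    case False
    then have "continuous_map ?X (discrete_topology UNIV) (\<lambda>a. True)" by simp
    then show ?thesis by (rule continuous_map_eq) (use False in \<open>simp add: u'_def\<close>)
  qed
  then have "continuous_map ?X P u'"
    unfolding P_def continuous_map_componentwise_UNIV by blast
  then have u': "u' \<in> ms_hom A Y"
    using bot by (auto simp: ms_hom_def Y_def u'_def)
  have "continuous_map ?X P (\<lambda>a U. True)"
    unfolding P_def continuous_map_componentwise_UNIV by simp
  then have "continuous_map ?X P v'" by (rule continuous_map_eq) (simp add: v'_def)
  then have v': "v' \<in> ms_hom A Y"
    using bot by (auto simp: ms_hom_def Y_def v'_def)
  have "?K = {a \<in> ms_carrier A. u' a = v' a}"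
  proof (intro equalityI subsetI)
    fix a assume "a \<in> ?K"
    then show "a \<in> {a \<in> ms_carrier A. u' a = v' a}"
      using gc by (auto simp: u'_def v'_def c_def fun_eq_iff continuous_map_def)
  next
    fix a assume a: "a \<in> {a \<in> ms_carrier A. u' a = v' a}"
    then have "c U \<Longrightarrow> a \<in> U" for U by (auto simp: u'_def v'_def fun_eq_iff)
    then show "a \<in> ?K" using sep a by blast
  qed
  then have "is_equaliser TYPE('w2) B A Y g u' v'"
    using R Y u' v' unfolding is_equaliser_iff by blast
  then show ?thesis unfolding regular_monic_def by blast
qed

end

theory Submission
  imports Defs
begin

text \<open>An arrow into \<^term>\<open>ms_D n\<close> is a clopen set on which the denominator is at least
  \<^term>\<open>sn_of_nat n\<close>.  Regular monics are the denominator-preserving closed embeddings, so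
  extending such an arrow along one amounts to finding a clopen set between a closed and an open set.
  Hence each \<^term>\<open>ms_D n\<close>, and therefore their product, is regular injective.
  Since \<open>enat k \<le> \<nu> p\<close> says that \<open>\<nu>\<close> is above the prime power \<open>p ^ k\<close>, the arrows into
  the factors \<open>p ^ k\<close> recover the denominator of an object, while those into \<^term>\<open>ms_D 1\<close>
  separate its points.  Finally, each of the countably many components of an arrow
  from a power of \<^term>\<open>ms_C\<close> is a clopen set, which by compactness depends on finitely many
  coordinates; the other coordinates can be filled with the zero point, whose denominator is
  least.\<close>

section \<open>Boolean spaces and their clopen sets\<close>

text \<open>Any clopen basis may be enlarged to the family of all clopen sets, so the existential
  over bases becomes a local condition at each point.\<close>

lemma boolean_space_iff:
  "boolean_space X \<longleftrightarrow> compact_space X \<and> Hausdorff_space X \<and>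
     (\<forall>S x. openin X S \<and> x \<in> S \<longrightarrow> (\<exists>U. openin X U \<and> closedin X U \<and> x \<in> U \<and> U \<subseteq> S))"
  unfolding boolean_space_def
proof (intro conj_cong refl iffI)
  assume "\<exists>\<B>. (\<forall>U\<in>\<B>. openin X U \<and> closedin X U) \<and> openin X = arbitrary union_of (\<lambda>U. U \<in> \<B>)"
  then show "\<forall>S x. openin X S \<and> x \<in> S \<longrightarrow> (\<exists>U. openin X U \<and> closedin X U \<and> x \<in> U \<and> U \<subseteq> S)"
    unfolding openin_topology_base_unique by meson
next
  assume "\<forall>S x. openin X S \<and> x \<in> S \<longrightarrow> (\<exists>U. openin X U \<and> closedin X U \<and> x \<in> U \<and> U \<subseteq> S)"
  then show "\<exists>\<B>. (\<forall>U\<in>\<B>. openin X U \<and> closedin X U) \<and> openin X = arbitrary union_of (\<lambda>U. U \<in> \<B>)"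
    by (intro exI [of _ "{U. openin X U \<and> closedin X U}"])
       (auto simp: openin_topology_base_unique)
qed

lemma boolean_space_product:
  assumes "\<And>i. i \<in> I \<Longrightarrow> boolean_space (X i)"
  shows "boolean_space (product_topology X I)"
  unfolding boolean_space_iff
proof (intro conjI allI impI)
  fix S x assume "openin (product_topology X I) S \<and> x \<in> S"
  then obtain U where fin: "finite {i \<in> I. U i \<noteq> topspace (X i)}"
    and U: "\<And>i. i \<in> I \<Longrightarrow> openin (X i) (U i)" and x: "x \<in> PiE I U" and S: "PiE I U \<subseteq> S"
    unfolding openin_product_topology_alt by meson
  \<comment> \<open>The last conjunct keeps the whole factor wherever \<open>U i\<close> is whole,
    so the smaller box still restricts only finitely many coordinates and remains open.\<close>
  have "\<exists>V. openin (X i) V \<and> closedin (X i) V \<and> x i \<in> V \<and> V \<subseteq> U i \<and>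
      (U i = topspace (X i) \<longrightarrow> V = topspace (X i))" if i: "i \<in> I" for i
  proof (cases "U i = topspace (X i)")
    case True
    then show ?thesis using i x by (intro exI [of _ "topspace (X i)"]) auto
  next
    case False
    then show ?thesis using assms [OF i] U [OF i] i x unfolding boolean_space_iff
      by (meson PiE_mem)
  qed
  then obtain V where V: "\<And>i. i \<in> I \<Longrightarrow> openin (X i) (V i) \<and> closedin (X i) (V i) \<and> x i \<in> V i \<and>
      V i \<subseteq> U i \<and> (U i = topspace (X i) \<longrightarrow> V i = topspace (X i))" by metis
  have "finite {i \<in> I. V i \<noteq> topspace (X i)}"
    by (rule finite_subset [OF _ fin]) (use V in auto)
  then have "openin (product_topology X I) (PiE I V)" "closedin (product_topology X I) (PiE I V)"
    using V by (auto simp: openin_PiE_gen closedin_product_topology)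
  moreover have "x \<in> PiE I V" using x V by auto
  moreover have "PiE I V \<subseteq> S" using V by (intro order_trans [OF PiE_mono S]) auto
  ultimately show "\<exists>U. openin (product_topology X I) U \<and> closedin (product_topology X I) U \<and>
      x \<in> U \<and> U \<subseteq> S" by blast
qed (use assms in \<open>auto simp: compact_space_product_topology Hausdorff_space_product_topology
        boolean_space_def\<close>)

text \<open>\<open>K\<close> is compact and is covered by the clopen subsets of \<open>V\<close>;
  the union of a finite subcover is again clopen.\<close>

lemma clopen_between:
  assumes X: "boolean_space X" and K: "closedin X K" and V: "openin X V" and "K \<subseteq> V"
  obtains U where "openin X U" "closedin X U" "K \<subseteq> U" "U \<subseteq> V"
proof -
  let ?\<U> = "{U. openin X U \<and> closedin X U \<and> U \<subseteq> V}"
  have "compactin X K" using X K by (auto simp: boolean_space_def closedin_compact_space)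
  moreover have "K \<subseteq> \<Union>?\<U>" using X V \<open>K \<subseteq> V\<close> unfolding boolean_space_iff by blast
  ultimately have "\<exists>F. finite F \<and> F \<subseteq> ?\<U> \<and> K \<subseteq> \<Union>F" by (intro compactinD) auto
  then obtain F where F: "finite F" "F \<subseteq> ?\<U>" "K \<subseteq> \<Union>F" by blast
  then have "openin X (\<Union>F)" "closedin X (\<Union>F)" by (auto intro!: openin_Union closedin_Union)
  with F that [of "\<Union>F"] show thesis by blast
qed

lemma continuous_map_bool_iff:
  "continuous_map X (discrete_topology UNIV) f \<longleftrightarrow>
     openin X {x \<in> topspace X. f x} \<and> closedin X {x \<in> topspace X. f x}" (is "_ \<longleftrightarrow> ?R")
proof
  assume L: "continuous_map X (discrete_topology UNIV) f"
  have "{x \<in> topspace X. f x} = {x \<in> topspace X. f x \<in> {True}}" by auto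
  then show ?R using openin_continuous_map_preimage [OF L, of "{True}"]
      closedin_continuous_map_preimage [OF L, of "{True}"] by auto
next
  assume R: ?R
  have "openin X {x \<in> topspace X. f x \<in> T}" for T
  proof -
    have "{x \<in> topspace X. f x \<in> T} = (if True \<in> T then {x \<in> topspace X. f x} else {}) \<union>
        (if False \<in> T then topspace X - {x \<in> topspace X. f x} else {})"
      by (auto split: if_splits) (metis (full_types))+
    then show ?thesis using R by (auto intro!: openin_Un openin_diff)
  qed
  then show "continuous_map X (discrete_topology UNIV) f" by (auto simp: continuous_map_def)
qed

text \<open>A compact open set is a finite union of open boxes, and each box restricts only finitely
  many coordinates; the union of these finite coordinate sets works for the whole set.\<close>

lemma clopen_product_finite_support:
  assumes S: "compactin (product_topology X I) S" "openin (product_topology X I) S"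
  shows "\<exists>J. finite J \<and> J \<subseteq> I \<and>
    (\<forall>x\<in>S. \<forall>y\<in>topspace (product_topology X I). (\<forall>i\<in>J. x i = y i) \<longrightarrow> y \<in> S)"
proof -
  \<comment> \<open>\<open>det J B\<close> expresses that membership in \<open>B\<close> depends
    only on the finitely many coordinates in \<open>J\<close>.\<close>
  define det where "det J B \<longleftrightarrow> finite J \<and> J \<subseteq> I \<and> (\<forall>x\<in>B. \<forall>y\<in>topspace (product_topology X I).
      (\<forall>i\<in>J. x i = y i) \<longrightarrow> y \<in> B)" for J B
  let ?\<U> = "{B. openin (product_topology X I) B \<and> B \<subseteq> S \<and> (\<exists>J. det J B)}"
  have "S \<subseteq> \<Union>?\<U>"
  proof
    fix x assume "x \<in> S"
    then obtain U where U: "finite {i \<in> I. U i \<noteq> topspace (X i)}"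
      "\<forall>i\<in>I. openin (X i) (U i)" "x \<in> PiE I U" "PiE I U \<subseteq> S"
      using S(2) unfolding openin_product_topology_alt by meson
    have "det {i \<in> I. U i \<noteq> topspace (X i)} (PiE I U)"
      unfolding det_def
    proof (intro conjI ballI impI)
      fix x y assume *: "x \<in> PiE I U" "y \<in> topspace (product_topology X I)"
        "\<forall>i\<in>{i \<in> I. U i \<noteq> topspace (X i)}. x i = y i"
      show "y \<in> PiE I U"
      proof (rule PiE_I)
        fix i assume "i \<in> I"
        then have "y i \<in> topspace (X i)" "x i \<in> U i" using * by auto
        then show "y i \<in> U i" using * \<open>i \<in> I\<close> by (cases "U i = topspace (X i)") auto
      qed (use * in \<open>auto simp: PiE_iff extensional_def\<close>)
    qed (use U in auto)
    moreover have "openin (product_topology X I) (PiE I U)"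
      using U by (auto simp: openin_PiE_gen)
    ultimately show "x \<in> \<Union>?\<U>" using U by blast
  qed
  then have "\<exists>F. finite F \<and> F \<subseteq> ?\<U> \<and> S \<subseteq> \<Union>F" by (intro compactinD [OF S(1)]) auto
  then obtain F where F: "finite F" "F \<subseteq> ?\<U>" "S \<subseteq> \<Union>F" by blast
  then have "\<forall>B\<in>F. \<exists>J. det J B" by blast
  then obtain J where J: "\<And>B. B \<in> F \<Longrightarrow> det (J B) B" by metis
  show ?thesis
  proof (intro exI [of _ "\<Union>B\<in>F. J B"] conjI ballI impI)
    show "finite (\<Union>B\<in>F. J B)" "(\<Union>B\<in>F. J B) \<subseteq> I" using F(1) J by (auto simp: det_def)
    fix x y assume *: "x \<in> S" "y \<in> topspace (product_topology X I)"
      "\<forall>i\<in>\<Union>B\<in>F. J B. x i = y i"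
    then obtain B where B: "B \<in> F" "x \<in> B" using F by blast
    then have "\<forall>i\<in>J B. x i = y i" using * by blast
    then have "y \<in> B" using J [OF B(1)] B *(2) unfolding det_def by blast
    then show "y \<in> S" using B F by blast
  qed
qed

section \<open>Supernatural numbers and continuity of denominators\<close>

lemma sn_of_nat_Suc_0: "sn_of_nat (Suc 0) = bot"
  using sn_up_1 by (intro antisym) (auto simp: sn_up_def)

text \<open>At every prime other than \<open>p\<close> the exponent of the prime power is zero, so
  only the value at \<open>p\<close> is constrained. Through this, denominators can be compared one
  prime and one exponent at a time.\<close>

lemma sn_of_nat_prime_power_le_iff:
  "sn_of_nat (Rep_prime_number p ^ k) \<le> \<nu> \<longleftrightarrow> enat k \<le> \<nu> p"
proof
  have p: "prime (Rep_prime_number q)" for q using Rep_prime_number by auto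
  have same: "multiplicity (Rep_prime_number p) (Rep_prime_number p ^ k) = k"
    using p [of p] by (simp add: multiplicity_same_power prime_gt_0_nat)
  show "enat k \<le> \<nu> p" if "sn_of_nat (Rep_prime_number p ^ k) \<le> \<nu>"
    using le_funD [OF that, of p] by (simp add: sn_of_nat_def same)
  show "sn_of_nat (Rep_prime_number p ^ k) \<le> \<nu>" if k: "enat k \<le> \<nu> p"
    unfolding sn_of_nat_def le_fun_def
  proof
    fix q
    show "enat (multiplicity (Rep_prime_number q) (Rep_prime_number p ^ k)) \<le> \<nu> q"
    proof (cases "p = q")
      case True
      then show ?thesis using k same by simp
    next
      case False
      then have "multiplicity (Rep_prime_number q) (Rep_prime_number p ^ k) = 0"
        using p by (intro multiplicity_distinct_prime_power)
          (auto simp: Rep_prime_number_inject)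
      then show ?thesis by (simp flip: zero_enat_def)
    qed
  qed
qed

lemma continuous_map_sn_iff:
  "continuous_map X sn_topology d \<longleftrightarrow>
     (\<forall>n\<ge>1. openin X {x \<in> topspace X. sn_of_nat n \<le> d x})" (is "?L \<longleftrightarrow> ?R")
proof
  assume L: ?L
  show ?R
  proof (intro allI impI)
    fix n :: nat assume "n \<ge> 1"
    then have "openin sn_topology (sn_up n)"
      unfolding sn_topology_def by (intro topology_generated_by_Basis) auto
    from openin_continuous_map_preimage [OF L this]
    show "openin X {x \<in> topspace X. sn_of_nat n \<le> d x}" by (simp add: sn_up_def)
  qed
next
  assume R: ?R
  show ?L unfolding sn_topology_def
  proof (rule continuous_on_generated_topo)
    fix U assume "U \<in> sn_up ` {1..}"
    then obtain n where "n \<ge> 1" "U = sn_up n" by auto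
    moreover have "d -` sn_up n \<inter> topspace X = {x \<in> topspace X. sn_of_nat n \<le> d x}"
      by (auto simp: sn_up_def)
    ultimately show "openin X (d -` U \<inter> topspace X)" using R by simp
  next
    have "\<Union>(sn_up ` {1..}) = UNIV" using sn_up_1 by fastforce
    then show "d ` topspace X \<subseteq> \<Union>(sn_up ` {1..})" by simp
  qed
qed

text \<open>Prime powers give a subbasis of the topology: lying above \<open>sn_of_nat n\<close> is
  a conjunction of conditions at the finitely many prime divisors of \<open>n\<close>. Conditions at
  a single prime are the convenient ones for joins of denominators.\<close>

lemma continuous_map_sn_iff_prime:
  "continuous_map X sn_topology d \<longleftrightarrow>
     (\<forall>p k. openin X {x \<in> topspace X. enat k \<le> d x p})" (is "?L \<longleftrightarrow> ?R")
proof
  assume ?L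
  then have "openin X {x \<in> topspace X. sn_of_nat (Rep_prime_number p ^ k) \<le> d x}" for p k
    using Rep_prime_number [of p] by (simp add: continuous_map_sn_iff Suc_le_eq prime_gt_0_nat)
  then show ?R by (simp only: sn_of_nat_prime_power_le_iff simp_thms)
next
  assume R: ?R
  show ?L unfolding continuous_map_sn_iff
  proof (intro allI impI)
    fix n :: nat assume n: "n \<ge> 1"
    let ?P = "{p. Rep_prime_number p dvd n}"
    let ?O = "\<lambda>p. {x \<in> topspace X. enat (multiplicity (Rep_prime_number p) n) \<le> d x p}"
    have "finite (Rep_prime_number ` ?P)"
      by (rule finite_subset [of _ "{..n}"]) (use n in \<open>auto dest: dvd_imp_le\<close>)
    then have fin: "finite ?P"
      by (rule finite_imageD) (auto simp: inj_on_def Rep_prime_number_inject)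
    have "enat (multiplicity (Rep_prime_number p) n) \<le> \<nu>" if "\<not> Rep_prime_number p dvd n" for p \<nu>
      using that by (simp add: not_dvd_imp_multiplicity_0 flip: zero_enat_def)
    \<comment> \<open>For \<open>n = 1\<close> there are no prime divisors and the intersection over
      \<open>?P\<close> is everything; the factor \<open>topspace X\<close> covers this
      case.\<close>
    then have "{x \<in> topspace X. sn_of_nat n \<le> d x} = topspace X \<inter> (\<Inter>p\<in>?P. ?O p)"
      unfolding sn_of_nat_def le_fun_def by blast
    also have "openin X \<dots>"
      using fin R by (cases "?P = {}") (auto intro!: openin_Int openin_INT2)
    finally show "openin X {x \<in> topspace X. sn_of_nat n \<le> d x}" .
  qed
qed

text \<open>If \<open>n\<close> is a finite \<open>j\<close> and \<open>m\<close> exceeds it, then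
  \<open>Suc j\<close> lies below \<open>m\<close> but not below \<open>n\<close>. This also covers
  an infinite \<open>m\<close>.\<close>

lemma enat_leI:
  assumes "\<And>k. enat k \<le> m \<Longrightarrow> enat k \<le> n"
  shows "m \<le> n"
proof (cases n)
  case (enat j)
  then show ?thesis using assms [of "Suc j"] by (metis Suc_ile_eq less_irrefl not_less)
qed simp

text \<open>Reaching \<open>Suc j\<close> means exceeding \<open>j\<close>, and a supremum exceeds
  \<open>j\<close> only if some member does. The threshold 0 is separate because \<open>I\<close>
  may be empty.\<close>

lemma enat_le_SUP_iff:
  fixes f :: "'i \<Rightarrow> enat"
  shows "enat k \<le> (SUP i\<in>I. f i) \<longleftrightarrow> k = 0 \<or> (\<exists>i\<in>I. enat k \<le> f i)"
  by (cases k) (simp_all add: zero_enat_def [symmetric] Suc_ile_eq less_SUP_iff)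

section \<open>Products of multisets and arrows into them\<close>

lemma is_ms_prod:
  assumes X: "\<And>i. i \<in> I \<Longrightarrow> is_ms (X i)"
  shows "is_ms (ms_prod X I)"
  unfolding is_ms_def
proof
  show "boolean_space (ms_space (ms_prod X I))"
    using X by (auto simp: ms_prod_def is_ms_def intro: boolean_space_product)
  let ?P = "product_topology (\<lambda>i. ms_space (X i)) I"
  have "openin ?P {x \<in> topspace ?P. enat k \<le> (SUP i\<in>I. denom (X i) (x i)) p}" for p k
  proof (cases "k = 0")
    case False
    \<comment> \<open>A positive finite exponent reached by the join is already reached in one
      factor, so the set is a union of preimages of open sets under projections, even when
      \<open>I\<close> is infinite.\<close>
    then have "{x \<in> topspace ?P. enat k \<le> (SUP i\<in>I. denom (X i) (x i)) p} =
        (\<Union>i\<in>I. {x \<in> topspace ?P. x i \<in> {y \<in> ms_carrier (X i). enat k \<le> denom (X i) y p}})"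
      by (auto simp: enat_le_SUP_iff SUP_apply)
    also have "openin ?P \<dots>"
    proof (intro openin_Union ballI, clarify)
      fix i assume i: "i \<in> I"
      show "openin ?P {x \<in> topspace ?P. x i \<in> {y \<in> ms_carrier (X i). enat k \<le> denom (X i) y p}}"
        by (rule openin_continuous_map_preimage [OF continuous_map_product_projection [OF i]])
          (use X [OF i] in \<open>auto simp: is_ms_def continuous_map_sn_iff_prime\<close>)
    qed
    finally show ?thesis .
  qed (simp flip: zero_enat_def del: topspace_product_topology)
  then show "continuous_map (ms_space (ms_prod X I)) sn_topology (denom (ms_prod X I))"
    by (simp add: ms_prod_def continuous_map_sn_iff_prime del: SUP_apply topspace_product_topology)
qed

lemma ms_carrier_prod: "ms_carrier (ms_prod X I) = PiE I (\<lambda>i. ms_carrier (X i))"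
  by (simp add: ms_prod_def)

text \<open>This is the universal property of the product: a join lies below
  \<open>denom A a\<close> exactly when each of its terms does. The components are restricted
  because arrows are extensional, and the condition on the image is there because points of the
  product are.\<close>

lemma ms_hom_prod_iff:
  "f \<in> ms_hom A (ms_prod X I) \<longleftrightarrow> f \<in> extensional (ms_carrier A) \<and>
     f ` ms_carrier A \<subseteq> extensional I \<and>
     (\<forall>i\<in>I. (\<lambda>a\<in>ms_carrier A. f a i) \<in> ms_hom A (X i))"
proof -
  have "continuous_map (ms_space A) Y (restrict g (ms_carrier A)) \<longleftrightarrow>
      continuous_map (ms_space A) Y g" for Y :: "'c topology" and g
    by (auto intro: continuous_map_eq)
  then show ?thesis
    by (auto simp: ms_hom_def ms_prod_def continuous_map_componentwise SUP_le_iff)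
qed

text \<open>The point \<open>False\<close> carries the least supernatural number, so only points
  sent to \<open>True\<close> restrict the denominator.\<close>

lemma ms_hom_D_iff:
  "f \<in> ms_hom A (ms_D n) \<longleftrightarrow> f \<in> extensional (ms_carrier A) \<and>
     openin (ms_space A) {x \<in> ms_carrier A. f x} \<and> closedin (ms_space A) {x \<in> ms_carrier A. f x} \<and>
     (\<forall>x\<in>ms_carrier A. f x \<longrightarrow> sn_of_nat n \<le> denom A x)"
  by (auto simp: ms_hom_def ms_D_def continuous_map_bool_iff sn_of_nat_Suc_0)

lemma is_ms_D: "is_ms (ms_D n)"
proof -
  have "boolean_space (discrete_topology (UNIV :: bool set))"
    by (auto simp: boolean_space_iff compact_space_discrete_topology)
  then show ?thesis by (simp add: is_ms_def ms_D_def topspace_sn_topology)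
qed

section \<open>Regular monics and regular injectivity\<close>

text \<open>The image of \<open>g\<close> is compact, hence closed, hence the intersection of the
  clopen sets containing it. A parallel pair into a power of \<open>ms_D 1\<close> that tests
  membership in all these clopen sets therefore has exactly this image as its equaliser.\<close>

lemma regular_monicI:
  fixes A :: "'a ms" and B :: "'b ms"
  assumes B: "is_ms B" and A: "is_ms A" and g: "g \<in> ms_hom B A"
    and inj: "inj_on g (ms_carrier B)"
    and den: "\<And>x. x \<in> ms_carrier B \<Longrightarrow> denom B x = denom A (g x)"
  shows "regular_monic TYPE('a set \<Rightarrow> bool) TYPE('w) B A g"
proof -
  let ?X = "ms_space A" and ?K = "g ` ms_carrier B"
  have gc: "continuous_map (ms_space B) ?X g" using g by (auto simp: ms_hom_def)
  have "compactin ?X ?K"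
    using image_compactin [OF _ gc] B by (simp add: is_ms_def boolean_space_def compact_space_def)
  then have K: "closedin ?X ?K"
    using A by (auto simp: is_ms_def boolean_space_def compactin_imp_closedin)
  define c where "c U \<longleftrightarrow> openin ?X U \<and> closedin ?X U \<and> ?K \<subseteq> U" for U
  \<comment> \<open>Every factor \<open>ms_D 1\<close> has the least denominator at both points, so
    arrows into \<open>Z\<close> only need continuity. Indices that fail \<open>c\<close> are
    harmless, since \<open>u\<close> and \<open>v\<close> are both \<open>True\<close>
    there.\<close>
  define Z where "Z = ms_prod (\<lambda>_. ms_D 1) (UNIV :: 'a set set)"
  define u where "u = (\<lambda>a\<in>ms_carrier A. \<lambda>U. c U \<longrightarrow> a \<in> U)"
  define v where "v = (\<lambda>a\<in>ms_carrier A. \<lambda>U :: 'a set. True)"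
  have "u \<in> ms_hom A Z" unfolding Z_def ms_hom_prod_iff ms_hom_D_iff
  proof (intro conjI ballI)
    fix U
    have "{x \<in> ms_carrier A. (\<lambda>a\<in>ms_carrier A. u a U) x} = (if c U then U else ms_carrier A)"
      by (auto simp: u_def c_def dest: openin_subset)
    then show "openin ?X {x \<in> ms_carrier A. (\<lambda>a\<in>ms_carrier A. u a U) x}"
      "closedin ?X {x \<in> ms_carrier A. (\<lambda>a\<in>ms_carrier A. u a U) x}"
      by (simp_all add: c_def)
  qed (auto simp: u_def sn_of_nat_Suc_0)
  moreover have "v \<in> ms_hom A Z" unfolding Z_def ms_hom_prod_iff ms_hom_D_iff
    by (auto simp: v_def sn_of_nat_Suc_0)
  moreover have "?K = {a \<in> ms_carrier A. u a = v a}"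
  proof (intro equalityI subsetI)
    fix a assume "a \<in> ?K"
    have "a \<in> ms_carrier A" using closedin_subset [OF K] \<open>a \<in> ?K\<close> by blast
    moreover have "c U \<longrightarrow> a \<in> U" for U using \<open>a \<in> ?K\<close> unfolding c_def by blast
    ultimately show "a \<in> {a \<in> ms_carrier A. u a = v a}" by (simp add: u_def v_def)
  next
    fix a assume a: "a \<in> {a \<in> ms_carrier A. u a = v a}"
    show "a \<in> ?K"
    proof (rule ccontr)
      assume "a \<notin> ?K"
      \<comment> \<open>A clopen set between the image and the complement of \<open>a\<close> is a
        coordinate at which \<open>u\<close> and \<open>v\<close> differ.\<close>
      have "openin ?X (ms_carrier A - {a})"
        using A a by (auto simp: is_ms_def boolean_space_def closedin_Hausdorff_singleton)
      moreover have "?K \<subseteq> ms_carrier A - {a}"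
        using closedin_subset [OF K] \<open>a \<notin> ?K\<close> by blast
      ultimately obtain U where "c U" "U \<subseteq> ms_carrier A - {a}"
        using A unfolding c_def is_ms_def by (metis clopen_between [OF _ K])
      moreover have "u a U = v a U" using a by simp
      ultimately show False using a by (auto simp: u_def v_def)
    qed
  qed
  moreover have "is_ms Z" unfolding Z_def by (intro is_ms_prod is_ms_D)
  ultimately have "is_equaliser TYPE('w) B A Z g u v"
    using assms unfolding is_equaliser_iff by blast
  then show ?thesis unfolding regular_monic_def by blast
qed

lemma regular_injective_D:
  assumes n: "n \<ge> 1"
  shows "regular_injective TYPE('b) TYPE('a) TYPE('z) TYPE('w) (ms_D n)"
  unfolding regular_injective_def
proof (intro conjI allI impI is_ms_D)
  fix B :: "'b ms" and A :: "'a ms" and g f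
  assume "is_ms B \<and> is_ms A \<and> regular_monic TYPE('z) TYPE('w) B A g \<and> f \<in> ms_hom B (ms_D n)"
  then have B: "is_ms B" and A: "is_ms A" and f: "f \<in> ms_hom B (ms_D n)"
    and inj: "inj_on g (ms_carrier B)" and g: "g \<in> ms_hom B A"
    and den: "\<And>x. x \<in> ms_carrier B \<Longrightarrow> denom B x = denom A (g x)"
    unfolding regular_monic_def is_equaliser_iff by auto
  have gc: "continuous_map (ms_space B) (ms_space A) g" using g by (auto simp: ms_hom_def)
  then have "closed_map (ms_space B) (ms_space A) g"
    using A B by (intro continuous_imp_closed_map) (auto simp: is_ms_def boolean_space_def)
  moreover define T where "T = {x \<in> ms_carrier B. f x}"
  moreover have "openin (ms_space B) T" "closedin (ms_space B) T"
    and fden: "\<And>x. x \<in> T \<Longrightarrow> sn_of_nat n \<le> denom B x"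
    using f by (auto simp: ms_hom_D_iff T_def)
  ultimately have K: "closedin (ms_space A) (g ` T)"
      "closedin (ms_space A) (g ` (ms_carrier B - T))"
    by (auto simp: closed_map_def)
  \<comment> \<open>An extension may be \<open>True\<close> only on \<open>V\<close>, which is open
    by continuity of the denominator, and must be \<open>False\<close> on the image of the
    complement of \<open>T\<close>. Below, equality of denominators puts the image of
    \<open>T\<close> inside \<open>V\<close>, and injectivity keeps the two images disjoint.\<close>
  define V where "V = {a \<in> ms_carrier A. sn_of_nat n \<le> denom A a}"
  have "openin (ms_space A) V" using A n by (auto simp: is_ms_def continuous_map_sn_iff V_def)
  then have "openin (ms_space A) (V - g ` (ms_carrier B - T))" using K by (intro openin_diff)
  moreover have "g ` T \<subseteq> V - g ` (ms_carrier B - T)"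
    using gc inj fden den
    by (auto simp: V_def T_def continuous_map_def inj_on_eq_iff)
  ultimately obtain U where U: "openin (ms_space A) U" "closedin (ms_space A) U" "g ` T \<subseteq> U"
      "U \<subseteq> V - g ` (ms_carrier B - T)"
    using clopen_between K A unfolding is_ms_def by metis
  define h where "h = (\<lambda>a\<in>ms_carrier A. a \<in> U)"
  have "{a \<in> ms_carrier A. h a} = U" using openin_subset [OF U(1)] by (auto simp: h_def)
  then have "h \<in> ms_hom A (ms_D n)"
    using U by (auto simp: ms_hom_D_iff h_def V_def)
  moreover have "ms_comp B h g = f"
  proof (rule extensionalityI [of _ "ms_carrier B"])
    fix x assume x: "x \<in> ms_carrier B"
    then have "g x \<in> ms_carrier A" using gc by (auto simp: continuous_map_def)
    moreover have "g x \<in> U \<longleftrightarrow> f x" using x U by (auto simp: T_def)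
    ultimately show "ms_comp B h g x = f x" using x by (simp add: compose_def h_def)
  qed (use f in \<open>auto simp: ms_hom_def\<close>)
  ultimately show "\<exists>h\<in>ms_hom A (ms_D n). ms_comp B h g = f" by blast
qed

text \<open>Each component of \<open>f\<close> extends separately, and by the universal property the
  chosen extensions assemble into one arrow.\<close>

lemma regular_injective_prod:
  assumes X: "\<And>i. i \<in> I \<Longrightarrow> regular_injective TYPE('b) TYPE('a) TYPE('z) TYPE('w) (X i)"
  shows "regular_injective TYPE('b) TYPE('a) TYPE('z) TYPE('w) (ms_prod X I)"
  unfolding regular_injective_def
proof (intro conjI allI impI)
  show "is_ms (ms_prod X I)" using X by (intro is_ms_prod) (auto simp: regular_injective_def)
  fix B :: "'b ms" and A :: "'a ms" and g f
  assume *: "is_ms B \<and> is_ms A \<and> regular_monic TYPE('z) TYPE('w) B A g \<and>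
    f \<in> ms_hom B (ms_prod X I)"
  have "\<exists>h\<in>ms_hom A (X i). ms_comp B h g = (\<lambda>b\<in>ms_carrier B. f b i)" if "i \<in> I" for i
    using X [OF that] * that unfolding regular_injective_def ms_hom_prod_iff by blast
  then obtain h where h: "\<And>i. i \<in> I \<Longrightarrow> h i \<in> ms_hom A (X i)"
      "\<And>i. i \<in> I \<Longrightarrow> ms_comp B (h i) g = (\<lambda>b\<in>ms_carrier B. f b i)" by metis
  define k where "k = (\<lambda>a\<in>ms_carrier A. \<lambda>i\<in>I. h i a)"
  have "(\<lambda>a\<in>ms_carrier A. k a i) = h i" if "i \<in> I" for i
    using h(1) [OF that] that by (auto simp: k_def ms_hom_def extensional_def fun_eq_iff)
  then have "k \<in> ms_hom A (ms_prod X I)"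
    using h(1) by (auto simp: ms_hom_prod_iff k_def)
  moreover have "ms_comp B k g = f"
  proof (rule extensionalityI [of _ "ms_carrier B"])
    fix x assume x: "x \<in> ms_carrier B"
    have "g \<in> ms_hom B A" using * unfolding regular_monic_def is_equaliser_def by blast
    then have gx: "g x \<in> ms_carrier A" using x by (auto simp: ms_hom_def continuous_map_def)
    show "ms_comp B k g x = f x"
    proof (rule extensionalityI [of _ I])
      fix i assume i: "i \<in> I"
      then show "ms_comp B k g x i = f x i"
        using fun_cong [OF h(2) [OF i], of x] x gx by (simp add: compose_def k_def)
    qed (use * x gx in \<open>auto simp: compose_def k_def ms_hom_prod_iff\<close>)
  qed (use * in \<open>auto simp: ms_hom_prod_iff\<close>)
  ultimately show "\<exists>h\<in>ms_hom A (ms_prod X I). ms_comp B h g = f" by blast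
qed

section \<open>The multiset C as a regular co-generator\<close>

definition prime_powers :: "nat set" where
  "prime_powers = {p ^ k | p k. prime p \<and> k \<ge> 1} \<union> {1}"

lemma ms_C_eq: "ms_C = ms_prod ms_D prime_powers"
  by (simp only: ms_C_def prime_powers_def)

lemma prime_powers_ge_1: "n \<in> prime_powers \<Longrightarrow> n \<ge> 1"
  by (auto simp: prime_powers_def Suc_le_eq prime_gt_0_nat)

lemma regular_injective_C: "regular_injective TYPE('b) TYPE('a) TYPE('z) TYPE('w) ms_C"
  unfolding ms_C_eq
  by (intro regular_injective_prod regular_injective_D prime_powers_ge_1)

lemma is_ms_C: "is_ms ms_C"
  unfolding ms_C_eq by (intro is_ms_prod is_ms_D)

text \<open>The indicator of \<open>U\<close> is placed in coordinate \<open>n\<close> and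
  \<open>False\<close> in all others, where it imposes no condition on denominators.\<close>

lemma indicator_hom_C:
  assumes n: "n \<in> prime_powers" and U: "openin (ms_space X) U" "closedin (ms_space X) U"
    and den: "\<And>x. x \<in> U \<Longrightarrow> sn_of_nat n \<le> denom X x"
  obtains t where "t \<in> ms_hom X ms_C" "\<And>x. x \<in> ms_carrier X \<Longrightarrow> t x n \<longleftrightarrow> x \<in> U"
proof
  let ?t = "\<lambda>x\<in>ms_carrier X. \<lambda>m\<in>prime_powers. m = n \<and> x \<in> U"
  show "?t \<in> ms_hom X ms_C"
    unfolding ms_C_eq ms_hom_prod_iff ms_hom_D_iff
  proof (intro conjI ballI)
    fix m assume "m \<in> prime_powers"
    then have "{x \<in> ms_carrier X. (\<lambda>a\<in>ms_carrier X. ?t a m) x} = (if m = n then U else {})"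
      using openin_subset [OF U(1)] by auto
    then show "openin (ms_space X) {x \<in> ms_carrier X. (\<lambda>a\<in>ms_carrier X. ?t a m) x}"
      "closedin (ms_space X) {x \<in> ms_carrier X. (\<lambda>a\<in>ms_carrier X. ?t a m) x}"
      using U by simp_all
  qed (use den in auto)
qed (use n in auto)

text \<open>By \<open>regular_monicI\<close> the canonical arrow only has to be injective and to
  preserve denominators exactly. The type of the equaliser's target is the one
  \<open>regular_monicI\<close> yields for the carrier type of the power.\<close>

lemma regular_cogenerator_C:
  "regular_cogenerator TYPE('x)
     TYPE((('x \<Rightarrow> nat \<Rightarrow> bool) \<Rightarrow> nat \<Rightarrow> bool) set \<Rightarrow> bool) TYPE('v) ms_C"
  unfolding regular_cogenerator_def
proof (intro conjI allI impI is_ms_C)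
  fix X :: "'x ms"
  assume X: "is_ms X"
  then have bs: "boolean_space (ms_space X)" by (simp add: is_ms_def)
  let ?H = "ms_hom X ms_C" and ?c = "canonical_arrow X ms_C"
  have "(\<lambda>x\<in>ms_carrier X. ?c x t) = t" if "t \<in> ?H" for t
    using that by (auto simp: canonical_arrow_def ms_hom_def extensional_def fun_eq_iff)
  then have hom: "?c \<in> ms_hom X (ms_power ms_C ?H)"
    unfolding ms_hom_prod_iff by (auto simp: canonical_arrow_def)
  show "regular_monic TYPE((('x \<Rightarrow> nat \<Rightarrow> bool) \<Rightarrow> nat \<Rightarrow> bool) set \<Rightarrow> bool) TYPE('v)
      X (ms_power ms_C ?H) ?c"
  proof (rule regular_monicI [OF X is_ms_prod hom])
    show "inj_on ?c (ms_carrier X)"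
    proof (rule inj_onI, rule ccontr)
      fix x y assume xy: "x \<in> ms_carrier X" "y \<in> ms_carrier X" "?c x = ?c y" "x \<noteq> y"
      have "openin (ms_space X) (ms_carrier X - {y})"
        using bs xy by (auto simp: boolean_space_def closedin_Hausdorff_singleton)
      then obtain U where U: "openin (ms_space X) U" "closedin (ms_space X) U" "x \<in> U" "y \<notin> U"
        using xy bs [unfolded boolean_space_iff, THEN conjunct2, THEN conjunct2, rule_format,
            of "ms_carrier X - {y}" x] by blast
      \<comment> \<open>The factor at index 1 admits every clopen set, so \<open>U\<close> itself
        separates the two points.\<close>
      obtain t where t: "t \<in> ?H" "\<And>z. z \<in> ms_carrier X \<Longrightarrow> t z 1 \<longleftrightarrow> z \<in> U"
        by (rule indicator_hom_C [OF _ U(1,2), of 1]) (auto simp: prime_powers_def sn_of_nat_Suc_0)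
      have "t x = t y"
        using fun_cong [OF xy(3), of t] t(1) xy by (simp add: canonical_arrow_def)
      then show False using t(2) xy U by metis
    qed
    fix x assume x: "x \<in> ms_carrier X"
    \<comment> \<open>The reverse inequality holds for every arrow. Here a clopen neighbourhood of
      \<open>x\<close> inside \<open>V\<close> gives an arrow \<open>t\<close> with
      \<open>t x n\<close> true, so the coordinate \<open>t\<close> of the power contributes the
      prime power \<open>n\<close> to the join.\<close>
    have le: "enat k \<le> denom (ms_power ms_C ?H) (?c x) p" if k: "enat k \<le> denom X x p" for p k
    proof (cases "k = 0")
      case False
      define n where "n = Rep_prime_number p ^ k"
      have n: "n \<in> prime_powers" 
        unfolding prime_powers_def n_def using False Rep_prime_number [of p]
        by (intro UnI1 CollectI exI [of _ "Rep_prime_number p"] exI [of _ k]) auto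
      define V where "V = {z \<in> ms_carrier X. sn_of_nat n \<le> denom X z}"
      have "openin (ms_space X) V"
        using X prime_powers_ge_1 [OF n] by (simp add: V_def is_ms_def continuous_map_sn_iff)
      moreover have "x \<in> V" using x k by (simp add: V_def n_def sn_of_nat_prime_power_le_iff)
      ultimately obtain U where U: "openin (ms_space X) U" "closedin (ms_space X) U" "x \<in> U" "U \<subseteq> V"
        using bs unfolding boolean_space_iff by meson
      obtain t where t: "t \<in> ?H" "\<And>z. z \<in> ms_carrier X \<Longrightarrow> t z n \<longleftrightarrow> z \<in> U"
        by (rule indicator_hom_C [OF n U(1,2)]) (use U(4) in \<open>auto simp: V_def\<close>)
      have "sn_of_nat n = denom (ms_D n) (t x n)" using t(2) x U by (simp add: ms_D_def)
      also have "\<dots> \<le> denom ms_C (t x)"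
        unfolding ms_C_eq by (simp only: ms_prod_def ms.sel) (rule SUP_upper [OF n])
      also have "\<dots> = denom ms_C (?c x t)" using t(1) x by (simp add: canonical_arrow_def)
      also have "\<dots> \<le> denom (ms_power ms_C ?H) (?c x)"
        by (simp only: ms_prod_def ms.sel) (rule SUP_upper [OF t(1)])
      finally show ?thesis by (simp add: n_def sn_of_nat_prime_power_le_iff)
    qed (simp flip: zero_enat_def)
    have "denom X x p \<le> denom (ms_power ms_C ?H) (?c x) p" for p
      by (rule enat_leI) (rule le)
    moreover have "denom (ms_power ms_C ?H) (?c x) \<le> denom X x"
      using hom x by (auto simp: ms_hom_def)
    ultimately show "denom X x = denom (ms_power ms_C ?H) (?c x)"
      by (intro antisym) (auto simp: le_fun_def)
  qed (rule is_ms_C)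
qed

section \<open>Countable support of arrows from powers of C\<close>

lemma factors_through_countable_subpower_C:
  assumes f: "f \<in> ms_hom (ms_power ms_C I) ms_C"
  shows "factors_through_countable_subpower I ms_C f"
proof -
  let ?P = "\<lambda>I. ms_power ms_C I"
  have fc: "continuous_map (ms_space (?P I)) (ms_space ms_C) f" using f by (simp add: ms_hom_def)
  have comp: "compact_space (ms_space (?P I))"
    using is_ms_prod [of I "\<lambda>_. ms_C"] is_ms_C by (auto simp: is_ms_def boolean_space_def)
  have "\<exists>J. finite J \<and> J \<subseteq> I \<and> (\<forall>x\<in>ms_carrier (?P I). \<forall>y\<in>ms_carrier (?P I).
      (\<forall>i\<in>J. x i = y i) \<longrightarrow> f x n = f y n)" if n: "n \<in> prime_powers" for n
  proof -
    define S where "S = {x \<in> ms_carrier (?P I). f x n}"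
    have "(\<lambda>x\<in>ms_carrier (?P I). f x n) \<in> ms_hom (?P I) (ms_D n)"
      using f n unfolding ms_C_eq ms_hom_prod_iff [where X = ms_D] by blast
    moreover have "{x \<in> ms_carrier (?P I). (\<lambda>x\<in>ms_carrier (?P I). f x n) x} = S"
      by (auto simp: S_def)
    ultimately have S: "openin (ms_space (?P I)) S" "closedin (ms_space (?P I)) S"
      by (simp_all add: ms_hom_D_iff)
    then have "compactin (ms_space (?P I)) S" using comp closedin_compact_space by blast
    with S(1) have "compactin (product_topology (\<lambda>_. ms_space ms_C) I) S"
        "openin (product_topology (\<lambda>_. ms_space ms_C) I) S"
      by (simp_all only: ms_prod_def ms.sel)
    from clopen_product_finite_support [OF this] obtain J where "finite J" "J \<subseteq> I"
      and J: "\<forall>x\<in>S. \<forall>y\<in>topspace (product_topology (\<lambda>_. ms_space ms_C) I).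
        (\<forall>i\<in>J. x i = y i) \<longrightarrow> y \<in> S" by (elim exE conjE)
    have "f x n = f y n"
      if "x \<in> ms_carrier (?P I)" "y \<in> ms_carrier (?P I)" "\<forall>i\<in>J. x i = y i" for x y
    proof -
      \<comment> \<open>Agreement on \<open>J\<close> is symmetric, so this one implication, used in
        both directions, gives equality of the truth values.\<close>
      have "y \<in> S" if "x \<in> S" "x \<in> ms_carrier (?P I)" "y \<in> ms_carrier (?P I)" "\<forall>i\<in>J. x i = y i" for x y
        using J that by (simp only: ms_prod_def ms.sel)
      from this [of x y] this [of y x] that show ?thesis by (auto simp: S_def)
    qed
    then show ?thesis using \<open>finite J\<close> \<open>J \<subseteq> I\<close> by (intro exI [of _ J] conjI ballI impI)
  qed
  then obtain J where J: "\<And>n. n \<in> prime_powers \<Longrightarrow> finite (J n) \<and> J n \<subseteq> I \<and>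
      (\<forall>x\<in>ms_carrier (?P I). \<forall>y\<in>ms_carrier (?P I). (\<forall>i\<in>J n. x i = y i) \<longrightarrow> f x n = f y n)"
    by metis
  \<comment> \<open>\<open>K\<close> is a union of finite sets indexed by a set of naturals, hence
    countable.\<close>
  define K where "K = (\<Union>n\<in>prime_powers. J n)"
  have "countable K" unfolding K_def using J by (intro countable_UN) (auto intro: countable_finite)
  have "K \<subseteq> I" unfolding K_def using J by blast
  have feq: "f x = f y" if xy: "x \<in> ms_carrier (?P I)" "y \<in> ms_carrier (?P I)"
      "\<forall>i\<in>K. x i = y i" for x y
  proof (rule extensionalityI [of _ prime_powers])
    show "f x \<in> extensional prime_powers" "f y \<in> extensional prime_powers"
      using xy f unfolding ms_C_eq ms_hom_prod_iff [where X = ms_D] by blast+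
    fix n assume n: "n \<in> prime_powers"
    then have "\<forall>i\<in>J n. x i = y i" using xy(3) unfolding K_def by blast
    then show "f x n = f y n" using J [OF n] xy by blast
  qed
  \<comment> \<open>\<open>z\<close> fills the coordinates outside \<open>K\<close>. Its denominator
    must be least so that padding a point does not enlarge the join.\<close>
  define z where "z = (\<lambda>n\<in>prime_powers. False)"
  have z: "z \<in> ms_carrier ms_C" by (simp add: z_def ms_C_eq ms_carrier_prod ms_D_def)
  have dz: "denom ms_C z = bot"
  proof -
    have "denom ms_C z = (SUP n\<in>prime_powers. denom (ms_D n) (z n))"
      by (simp only: ms_C_eq ms_prod_def ms.sel)
    also have "\<dots> = (SUP n\<in>prime_powers. bot)"
      by (rule SUP_cong) (auto simp: z_def ms_D_def sn_of_nat_Suc_0)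
    finally show ?thesis by simp
  qed
  define ext where "ext y = (\<lambda>i\<in>I. if i \<in> K then y i else z)" for y :: "'a \<Rightarrow> nat \<Rightarrow> bool"
  have extc: "continuous_map (ms_space (?P K)) (ms_space (?P I)) ext"
    unfolding ms_prod_def ms.sel continuous_map_componentwise
  proof (intro conjI ballI)
    fix i assume "i \<in> I"
    then show "continuous_map (product_topology (\<lambda>_. ms_space ms_C) K) (ms_space ms_C)
        (\<lambda>y. ext y i)"
      by (cases "i \<in> K") (auto simp: ext_def z intro: continuous_map_product_projection)
  qed (auto simp: ext_def)
  \<comment> \<open>Equality of the joins is what makes \<open>f\<close> composed with
    \<open>ext\<close> respect denominators on the smaller power.\<close>
  have extd: "denom (?P I) (ext y) = denom (?P K) y" for y
  proof -
    have "(SUP i\<in>I. denom ms_C (ext y i)) = (SUP i\<in>K. denom ms_C (y i))"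
    proof (intro antisym SUP_least)
      fix i assume "i \<in> I"
      then show "denom ms_C (ext y i) \<le> (SUP i\<in>K. denom ms_C (y i))"
        by (cases "i \<in> K") (auto simp: ext_def dz intro!: SUP_upper simp del: SUP_apply)
    next
      fix i assume "i \<in> K"
      then show "denom ms_C (y i) \<le> (SUP i\<in>I. denom ms_C (ext y i))"
        using \<open>K \<subseteq> I\<close> by (intro SUP_upper2 [of i]) (auto simp: ext_def)
    qed
    then show ?thesis by (simp only: ms_prod_def ms.sel)
  qed
  define g where "g = ms_comp (?P K) f ext"
  have extm: "ext y \<in> ms_carrier (?P I)" if "y \<in> ms_carrier (?P K)" for y
    using extc that by (auto simp: continuous_map_def)
  have "continuous_map (ms_space (?P K)) (ms_space ms_C) g"
    using continuous_map_compose [OF extc fc]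
    by (rule continuous_map_eq) (simp add: g_def compose_def)
  moreover have "denom ms_C (g y) \<le> denom (?P K) y" if "y \<in> ms_carrier (?P K)" for y
    using f extm [OF that] that extd [of y] by (auto simp: ms_hom_def g_def compose_def)
  ultimately have g: "g \<in> ms_hom (?P K) ms_C" by (auto simp: ms_hom_def g_def)
  have "f = ms_comp (?P I) g (\<lambda>x\<in>ms_carrier (?P I). restrict x K)"
  proof (rule extensionalityI [of _ "ms_carrier (?P I)"])
    fix x assume x: "x \<in> ms_carrier (?P I)"
    then have r: "restrict x K \<in> ms_carrier (?P K)"
      using \<open>K \<subseteq> I\<close> by (auto simp: ms_carrier_prod)
    \<comment> \<open>Restricting to \<open>K\<close> and padding with \<open>z\<close> may change
      \<open>x\<close> outside \<open>K\<close>, but \<open>f\<close> does not see those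
      coordinates.\<close>
    then have "f x = f (ext (restrict x K))"
      using \<open>K \<subseteq> I\<close> by (intro feq x extm) (auto simp: ext_def)
    then show "f x = ms_comp (?P I) g (\<lambda>x\<in>ms_carrier (?P I). restrict x K) x"
      using x r by (simp add: compose_def g_def)
  qed (use f in \<open>auto simp: ms_hom_def\<close>)
  then show ?thesis
    unfolding factors_through_countable_subpower_def
    using \<open>K \<subseteq> I\<close> \<open>countable K\<close> g by blast
qed

theorem lemma4p5:
  fixes I :: "'i set"
  shows "regular_injective TYPE('b) TYPE('a) TYPE('z) TYPE('w) ms_C \<and>
    regular_cogenerator TYPE('x)
      TYPE((('x \<Rightarrow> nat \<Rightarrow> bool) \<Rightarrow> nat \<Rightarrow> bool) set \<Rightarrow> bool) TYPE('v) ms_C \<and>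
    (\<forall>f \<in> ms_hom (ms_power ms_C I) ms_C. factors_through_countable_subpower I ms_C f)"
  using regular_injective_C regular_cogenerator_C factors_through_countable_subpower_C by blast

end
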